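(* Consider a work-conserving system with random sleep scheduling in discrete time and random service increments $Z(t)$, $t\ge0$. The system enters the sleep state at time $0$ and wakes up after a random time $T\ge0$, i.e., $Z(t)=0$ for $t\in[0,T]$. Let $S(\tau,t)=\sum_{\upsilon=\tau+1}^{t}Z(\upsilon)$ for all $t>\tau\ge0$ and $S(t,t)=0$ for all $t\ge0$, and let $U(\tau,t)=[t-\max\{\tau,T\}]_+$ be the number of usable time-slots in $(\tau,t]$, i.e., those after time $T$. Then $$\mathsf{M}_U(\theta,\tau,t)=e^{\theta(t-\tau)}\mathsf{P}[T\le\tau]+\sum_{\upsilon=\tau+1}^{t}e^{\theta(t-\upsilon)}\mathsf{P}[T=\upsilon]+\mathsf{P}[T>t].$$ Moreover, given that the service increments $Z(t)$ for $t>T$ are iid with moment generating function $\mathsf{M}_Z(\theta)$, the moment generating function of the service process is $$\mathsf{M}_S(\theta,\tau,t)=\mathsf{E}\bigl[(\mathsf{M}_Z(\theta))^{U(\tau,t)}\bigr]=\mathsf{M}_U(\ln\mathsf{M}_Z(\theta),\tau,t).$$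
   Context: Time is slotted: $\tau,t,\upsilon$ are non-negative integers with $t\ge\tau\ge0$, and $T$ takes non-negative integer values. $[x]_+=\max\{0,x\}$. $\mathsf{M}_Z(\theta)=\mathsf{E}[e^{\theta Z}]$ is the moment generating function of a single service increment $Z$ after wake-up, $\mathsf{M}_U(\theta,\tau,t)=\mathsf{E}[e^{\theta U(\tau,t)}]$, and $\mathsf{M}_S(\theta,\tau,t)=\mathsf{E}[e^{\theta S(\tau,t)}]$. *)

theory Defs
  imports "HOL-Probability.Probability"
begin

definition mgf :: "'a measure \<Rightarrow> ('a \<Rightarrow> real) \<Rightarrow> real \<Rightarrow> real" where
  "mgf M X \<theta> = (\<integral>\<omega>. exp (\<theta> * X \<omega>) \<partial>M)"

definition service :: "(nat \<Rightarrow> 'a \<Rightarrow> real) \<Rightarrow> nat \<Rightarrow> nat \<Rightarrow> 'a \<Rightarrow> real" where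
  "service Z \<tau> t \<omega> = (\<Sum>\<upsilon> = \<tau> + 1..t. Z \<upsilon> \<omega>)"

(* The truncated subtraction of natural numbers is the positive part [t - max {tau, T}]_+. *)
definition usable_slots :: "('a \<Rightarrow> nat) \<Rightarrow> nat \<Rightarrow> nat \<Rightarrow> 'a \<Rightarrow> nat" where
  "usable_slots T \<tau> t \<omega> = t - max \<tau> (T \<omega>)"

(* The index set of the increments Z(t), t > T, is random.  That they are iid with law D is
   therefore read conditionally on T: for each value k that T takes with positive probability,
   the variables Z(t), t > k, are independent with law D under the conditional probability
   given T = k, which is uniform_measure M {T = k}.  The law D does not depend on k. *)
definition iid_after_wakeup ::
    "'a measure \<Rightarrow> (nat \<Rightarrow> 'a \<Rightarrow> real) \<Rightarrow> ('a \<Rightarrow> nat) \<Rightarrow> real measure \<Rightarrow> bool" where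
  "iid_after_wakeup M Z T D \<longleftrightarrow>
     (\<forall>k. \<P>(\<omega> in M. T \<omega> = k) > 0 \<longrightarrow>
        prob_space.indep_vars (uniform_measure M {\<omega> \<in> space M. T \<omega> = k})
          (\<lambda>_. borel) Z {k<..} \<and>
        (\<forall>t>k. distr (uniform_measure M {\<omega> \<in> space M. T \<omega> = k}) borel (Z t) = D))"

end

(* Split the probability space along the finitely many events {T = k}, k < t, and {T >= t}.
   On {T = k} the sum S(tau,t) only sees the increments after max tau k, which are iid given
   T = k, so its conditional moment generating function is the power M_Z ^ (t - max tau k);
   on {T >= t} the service vanishes.  In particular no infinite sum over the values of T occurs. *)

theory Submission
  imports Defs
begin

section \<open>Conditioning on an event of positive probability\<close>

text \<open>Positivity of \<open>measure M A\<close> keeps the extended-real quotient finite, so the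
  density is the image of a real function. This is the form that
  \<open>integrable_real_density\<close> and \<open>integral_real_density\<close> accept.\<close>

lemma uniform_measure_eq_density_measure:
  assumes "finite_measure M" and "A \<in> sets M" and "measure M A > 0"
  shows "uniform_measure M A = density M (\<lambda>x. ennreal (indicator A x / measure M A))"
proof -
  interpret finite_measure M by fact
  have "indicator A x / emeasure M A = ennreal (indicator A x / measure M A)" for x
    using assms(3)
      by (auto simp: emeasure_eq_measure divide_ennreal ennreal_indicator[symmetric]
          simp del: ennreal_indicator)
  then show ?thesis
    by (simp add: uniform_measure_def)
qed

text \<open>The density is the constant \<open>1 / measure M A\<close> on \<open>A\<close> and 0
  elsewhere, so only a nonzero factor separates the two integrals. This translates between
  expectations given \<open>A\<close> and the restricted integrals over \<open>M\<close> that arise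
  from splitting along the values of \<open>T\<close>.\<close>

lemma
  fixes f :: "'a \<Rightarrow> real"
  assumes "finite_measure M" and "A \<in> sets M" and "measure M A > 0"
    and "f \<in> borel_measurable M"
  shows integrable_uniform_measure_iff:
      "integrable (uniform_measure M A) f \<longleftrightarrow> integrable M (\<lambda>x. indicator A x * f x)" (is ?int)
    and integral_indicator_eq_uniform_measure:
      "(\<integral>x. indicator A x * f x \<partial>M) = measure M A * (\<integral>x. f x \<partial>uniform_measure M A)" (is ?eq)
proof -
  have [measurable]: "A \<in> sets M" by fact
  note dens = uniform_measure_eq_density_measure[OF assms(1-3)]
  have "integrable (uniform_measure M A) f
      \<longleftrightarrow> integrable M (\<lambda>x. indicator A x / measure M A * f x)"
    unfolding dens using assms(4) by (intro integrable_real_density) auto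
  also have "(\<lambda>x. indicator A x / measure M A * f x)
      = (\<lambda>x. (1 / measure M A) * (indicator A x * f x))"
    by simp
  finally show ?int
    using assms(3) by (simp only: integrable_mult_left_iff) simp
  have "(\<integral>x. f x \<partial>uniform_measure M A) = (\<integral>x. indicator A x / measure M A * f x \<partial>M)"
    unfolding dens using assms(4) by (intro integral_real_density) auto
  then show ?eq
    using assms(3) by simp
qed

section \<open>Moment generating functions of iid sums\<close>

text \<open>The exponential turns the sum into a product, and independence lets the expectation
  factor. An empty \<open>I\<close> is allowed and yields 1. Integrability is a conclusion of its
  own because the Bochner integral of a non-integrable function is 0 by default.\<close>

lemma (in prob_space)
  fixes X :: "'i \<Rightarrow> 'a \<Rightarrow> real"
  assumes "finite I" and "indep_vars (\<lambda>_. borel) X I"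
    and law: "\<And>i. i \<in> I \<Longrightarrow> distr M borel (X i) = D"
    and int: "integrable D (\<lambda>z. exp (\<theta> * z))"
  shows integrable_exp_sum_iid: "integrable M (\<lambda>\<omega>. exp (\<theta> * (\<Sum>i\<in>I. X i \<omega>)))" (is ?int)
    and mgf_sum_iid: "mgf M (\<lambda>\<omega>. \<Sum>i\<in>I. X i \<omega>) \<theta> = mgf D (\<lambda>z. z) \<theta> ^ card I" (is ?eq)
proof -
  have meas: "X i \<in> borel_measurable M" if "i \<in> I" for i
    using assms(2) that by (auto simp: indep_vars_def2)
  have indep: "indep_vars (\<lambda>_. borel) (\<lambda>i \<omega>. exp (\<theta> * X i \<omega>)) I"
    using indep_vars_compose2[OF assms(2), of "\<lambda>_ z. exp (\<theta> * z)" "\<lambda>_. borel"] by simp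
  have int': "integrable M (\<lambda>\<omega>. exp (\<theta> * X i \<omega>))" if "i \<in> I" for i
    using int unfolding law[OF that, symmetric]
    by (subst (asm) integrable_distr_eq) (auto intro: meas that)
  have mgf': "(\<integral>\<omega>. exp (\<theta> * X i \<omega>) \<partial>M) = mgf D (\<lambda>z. z) \<theta>" if "i \<in> I" for i
    unfolding mgf_def law[OF that, symmetric]
    by (subst integral_distr) (auto intro: meas that)
  have prod: "exp (\<theta> * (\<Sum>i\<in>I. X i \<omega>)) = (\<Prod>i\<in>I. exp (\<theta> * X i \<omega>))" for \<omega>
    by (simp add: sum_distrib_left exp_sum assms(1))
  show ?int
    unfolding prod by (rule indep_vars_integrable[OF assms(1) indep int'])
  have "mgf M (\<lambda>\<omega>. \<Sum>i\<in>I. X i \<omega>) \<theta> = (\<Prod>i\<in>I. \<integral>\<omega>. exp (\<theta> * X i \<omega>) \<partial>M)"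
    unfolding mgf_def prod by (rule indep_vars_lebesgue_integral[OF assms(1) indep int'])
  then show ?eq
    by (simp add: mgf')
qed

text \<open>If the integral of the strictly positive \<open>exp (\<theta> * z)\<close> were 0, the
  function would vanish almost everywhere, which is impossible under a probability measure.
  Integrability excludes the default value 0 of the integral.\<close>

lemma (in prob_space) mgf_law_pos:
  assumes "X \<in> borel_measurable M" and "distr M borel X = D"
    and "integrable D (\<lambda>z. exp (\<theta> * z))"
  shows "mgf D (\<lambda>z. z) \<theta> > 0"
proof -
  interpret D: prob_space D
    using assms(1) unfolding assms(2)[symmetric] by (rule prob_space_distr)
  have "mgf D (\<lambda>z. z) \<theta> \<noteq> 0"
    unfolding mgf_def using integral_nonneg_eq_0_iff_AE[OF assms(3)] by (auto simp: D.AE_False)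
  moreover have "mgf D (\<lambda>z. z) \<theta> \<ge> 0"
    unfolding mgf_def by simp
  ultimately show ?thesis by simp
qed

section \<open>Finite partitions along the values of a random time\<close>

text \<open>Where \<open>T\<close> is at least \<open>n\<close> the function is the constant
  \<open>c n\<close>, so all these values of \<open>T\<close> form a single block. Linearity of the
  integral over the finitely many blocks does the rest.\<close>

lemma (in prob_space)
  fixes f :: "'a \<Rightarrow> real" and T :: "'a \<Rightarrow> nat"
  assumes T [measurable]: "T \<in> measurable M (count_space UNIV)"
    and int: "\<And>k. k < n \<Longrightarrow> integrable M (\<lambda>\<omega>. indicator {\<omega> \<in> space M. T \<omega> = k} \<omega> * f \<omega>)"
    and eq: "\<And>k. k < n \<Longrightarrow> (\<integral>\<omega>. indicator {\<omega> \<in> space M. T \<omega> = k} \<omega> * f \<omega> \<partial>M)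
               = c k * \<P>(\<omega> in M. T \<omega> = k)"
    and const: "\<And>\<omega>. \<omega> \<in> space M \<Longrightarrow> n \<le> T \<omega> \<Longrightarrow> f \<omega> = c n"
  shows integrable_truncated_partition: "integrable M f" (is ?int)
    and integral_truncated_partition:
      "(\<integral>\<omega>. f \<omega> \<partial>M) = (\<Sum>k<n. c k * \<P>(\<omega> in M. T \<omega> = k)) + c n * \<P>(\<omega> in M. n \<le> T \<omega>)" (is ?eq)
proof -
  let ?g = "\<lambda>\<omega>. (\<Sum>k<n. indicator {\<omega> \<in> space M. T \<omega> = k} \<omega> * f \<omega>)
              + c n * indicator {\<omega> \<in> space M. n \<le> T \<omega>} \<omega>"
  have decomp: "f \<omega> = ?g \<omega>" if "\<omega> \<in> space M" for \<omega>
  proof -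
    \<comment> \<open>At most one summand survives, the one with \<open>k = T \<omega>\<close>, and
      only if \<open>T \<omega> < n\<close>; otherwise the tail indicator takes over.\<close>
    have "(\<Sum>k<n. indicator {\<omega> \<in> space M. T \<omega> = k} \<omega> * f \<omega>)
        = (\<Sum>k<n. if k = T \<omega> then f \<omega> else 0)"
      using that by (intro sum.cong) (auto simp: indicator_def)
    then show ?thesis
      using that const by (auto simp: sum.delta indicator_def)
  qed
  have int': "integrable M ?g"
    using int by (intro Bochner_Integration.integrable_add Bochner_Integration.integrable_sum
          integrable_mult_right integrable_real_indicator) (auto simp: emeasure_eq_measure)
  then show ?int
    by (rule Bochner_Integration.integrable_cong[OF refl decomp, THEN iffD2, rotated])
  have "(\<integral>\<omega>. f \<omega> \<partial>M) = (\<integral>\<omega>. ?g \<omega> \<partial>M)"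
    using decomp by (rule Bochner_Integration.integral_cong[OF refl])
  also have "\<dots> = (\<Sum>k<n. c k * \<P>(\<omega> in M. T \<omega> = k)) + c n * \<P>(\<omega> in M. n \<le> T \<omega>)"
  proof -
    have "(\<integral>\<omega>. (\<Sum>k<n. indicator {\<omega> \<in> space M. T \<omega> = k} \<omega> * f \<omega>) \<partial>M)
        = (\<Sum>k<n. c k * \<P>(\<omega> in M. T \<omega> = k))"
      using int eq by (subst Bochner_Integration.integral_sum) auto
    moreover have "integrable M (\<lambda>\<omega>. c n * indicator {\<omega> \<in> space M. n \<le> T \<omega>} \<omega>)"
      by (intro integrable_mult_right integrable_real_indicator) (auto simp: emeasure_eq_measure)
    moreover have "integrable M (\<lambda>\<omega>. \<Sum>k<n. indicator {\<omega> \<in> space M. T \<omega> = k} \<omega> * f \<omega>)"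
      using int by (intro Bochner_Integration.integrable_sum) auto
    ultimately show ?thesis
      by (subst Bochner_Integration.integral_add) auto
  qed
  finally show ?eq .
qed

text \<open>A function of \<open>T\<close> alone is constant on each block. This brings the
  expectation of the power of \<open>mgf D\<close> with exponent \<open>usable_slots\<close> to the
  same finite sum as the moment generating function of the service.\<close>

lemma (in prob_space) integral_truncated_nat:
  fixes c :: "nat \<Rightarrow> real" and T :: "'a \<Rightarrow> nat"
  assumes T [measurable]: "T \<in> measurable M (count_space UNIV)"
    and const: "\<And>k. n \<le> k \<Longrightarrow> c k = c n"
  shows "(\<integral>\<omega>. c (T \<omega>) \<partial>M) = (\<Sum>k<n. c k * \<P>(\<omega> in M. T \<omega> = k)) + c n * \<P>(\<omega> in M. n \<le> T \<omega>)"
proof -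
  have restrict: "indicator {\<omega> \<in> space M. T \<omega> = k} \<omega> * c (T \<omega>)
      = c k * indicator {\<omega> \<in> space M. T \<omega> = k} \<omega>" for k \<omega>
    by (simp add: indicator_def)
  show ?thesis
  proof (rule integral_truncated_partition[OF T])
    show "integrable M (\<lambda>\<omega>. indicator {\<omega> \<in> space M. T \<omega> = k} \<omega> * c (T \<omega>))" for k
      unfolding restrict
      by (intro integrable_mult_right integrable_real_indicator) (auto simp: emeasure_eq_measure)
    show "(\<integral>\<omega>. indicator {\<omega> \<in> space M. T \<omega> = k} \<omega> * c (T \<omega>) \<partial>M)
        = c k * \<P>(\<omega> in M. T \<omega> = k)" for k
      unfolding restrict by simp
    show "c (T \<omega>) = c n" if "n \<le> T \<omega>" for \<omega>
      using that by (rule const)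
  qed
qed

section \<open>The number of usable slots\<close>

text \<open>The exponential is a step function of \<open>T\<close>: one value for all
  \<open>T\<close> up to \<tau>, one for each slot in between, and the value 1 beyond
  \<open>t\<close>. The assumption \<open>\<tau> \<le> t\<close> makes truncated and real
  subtraction agree in the first two cases.\<close>

lemma (in prob_space) mgf_usable_slots:
  fixes T :: "'a \<Rightarrow> nat"
  assumes T [measurable]: "T \<in> measurable M (count_space UNIV)" and "\<tau> \<le> t"
  shows "mgf M (\<lambda>\<omega>. real (usable_slots T \<tau> t \<omega>)) \<theta> =
           exp (\<theta> * (real t - real \<tau>)) * \<P>(\<omega> in M. T \<omega> \<le> \<tau>)
           + (\<Sum>\<upsilon> = \<tau> + 1..t. exp (\<theta> * (real t - real \<upsilon>)) * \<P>(\<omega> in M. T \<omega> = \<upsilon>))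
           + \<P>(\<omega> in M. T \<omega> > t)"
proof -
  have "exp (\<theta> * real (usable_slots T \<tau> t \<omega>))
      = exp (\<theta> * (real t - real \<tau>)) * indicator {\<omega> \<in> space M. T \<omega> \<le> \<tau>} \<omega>
        + (\<Sum>\<upsilon> = \<tau> + 1..t. exp (\<theta> * (real t - real \<upsilon>)) * indicator {\<omega> \<in> space M. T \<omega> = \<upsilon>} \<omega>)
        + indicator {\<omega> \<in> space M. T \<omega> > t} \<omega>" (is "_ = ?g \<omega>")
    if "\<omega> \<in> space M" for \<omega>
  proof -
    have "(\<Sum>\<upsilon> = \<tau> + 1..t. exp (\<theta> * (real t - real \<upsilon>)) * indicator {\<omega> \<in> space M. T \<omega> = \<upsilon>} \<omega>)
        = (\<Sum>\<upsilon> = \<tau> + 1..t. if \<upsilon> = T \<omega> then exp (\<theta> * (real t - real (T \<omega>))) else 0)"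
      using that by (intro sum.cong) (auto simp: indicator_def)
    then show ?thesis
      using that assms(2)
      by (auto simp: sum.delta indicator_def usable_slots_def max_def of_nat_diff)
  qed
  then have "mgf M (\<lambda>\<omega>. real (usable_slots T \<tau> t \<omega>)) \<theta> = (\<integral>\<omega>. ?g \<omega> \<partial>M)"
    unfolding mgf_def by (intro Bochner_Integration.integral_cong) auto
  also have "\<dots> = exp (\<theta> * (real t - real \<tau>)) * \<P>(\<omega> in M. T \<omega> \<le> \<tau>)
      + (\<Sum>\<upsilon> = \<tau> + 1..t. exp (\<theta> * (real t - real \<upsilon>)) * \<P>(\<omega> in M. T \<omega> = \<upsilon>))
      + \<P>(\<omega> in M. T \<omega> > t)"
  proof -
    have int: "integrable M (indicator {\<omega> \<in> space M. P (T \<omega>)} :: 'a \<Rightarrow> real)" for P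
      by (intro integrable_real_indicator) (auto simp: emeasure_eq_measure)
    then have "integrable M (\<lambda>\<omega>. \<Sum>\<upsilon> = \<tau> + 1..t.
        exp (\<theta> * (real t - real \<upsilon>)) * indicator {\<omega> \<in> space M. T \<omega> = \<upsilon>} \<omega>)"
      by (intro Bochner_Integration.integrable_sum integrable_mult_right)
    moreover have "(\<integral>\<omega>. (\<Sum>\<upsilon> = \<tau> + 1..t.
          exp (\<theta> * (real t - real \<upsilon>)) * indicator {\<omega> \<in> space M. T \<omega> = \<upsilon>} \<omega>) \<partial>M)
        = (\<Sum>\<upsilon> = \<tau> + 1..t. exp (\<theta> * (real t - real \<upsilon>)) * \<P>(\<omega> in M. T \<omega> = \<upsilon>))"
      using int by (subst Bochner_Integration.integral_sum) auto
    \<comment> \<open>The sum keeps its fixed index set; \<open>sum_mult_indicator\<close> would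
      make the index set depend on \<omega>.\<close>
    ultimately show ?thesis
      using int[of "\<lambda>k. k \<le> \<tau>"] int[of "\<lambda>k. t < k"]
      by (simp del: sum_mult_indicator)
  qed
  finally show ?thesis .
qed

section \<open>The service process given the wake-up time\<close>

lemma
  assumes "prob_space M"
    and T [measurable]: "T \<in> measurable M (count_space UNIV)"
    and Z [measurable]: "\<And>s. Z s \<in> borel_measurable M"
    and sleep: "\<And>\<omega> s. \<omega> \<in> space M \<Longrightarrow> s \<le> T \<omega> \<Longrightarrow> Z s \<omega> = 0"
    and iid: "iid_after_wakeup M Z T D" and int: "integrable D (\<lambda>z. exp (\<theta> * z))"
  shows integrable_exp_service_given_wakeup:
      "integrable M (\<lambda>\<omega>. indicator {\<omega> \<in> space M. T \<omega> = k} \<omega> * exp (\<theta> * service Z \<tau> t \<omega>))"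
        (is ?int)
    and integral_exp_service_given_wakeup:
      "(\<integral>\<omega>. indicator {\<omega> \<in> space M. T \<omega> = k} \<omega> * exp (\<theta> * service Z \<tau> t \<omega>) \<partial>M)
        = mgf D (\<lambda>z. z) \<theta> ^ (t - max \<tau> k) * \<P>(\<omega> in M. T \<omega> = k)" (is ?eq)
proof -
  interpret prob_space M by fact
  define A where "A = {\<omega> \<in> space M. T \<omega> = k}"
  have A [measurable]: "A \<in> sets M"
    unfolding A_def by measurable
  have [measurable]: "service Z \<tau> t \<in> borel_measurable M"
    unfolding service_def[abs_def] by measurable
  have "?int \<and> ?eq"
  \<comment> \<open>\<open>iid_after_wakeup\<close> is silent about null events, where no
    conditional probability exists; there both sides are 0.\<close>
  proof (cases "prob A = 0")
    case True
    then have "A \<in> null_sets M"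
      by (intro null_setsI A) (simp add: emeasure_eq_measure)
    then have null: "AE \<omega> in M. indicator A \<omega> * exp (\<theta> * service Z \<tau> t \<omega>) = 0"
      by (auto dest!: AE_not_in elim!: eventually_mono)
    have "integrable M (\<lambda>\<omega>. indicator A \<omega> * exp (\<theta> * service Z \<tau> t \<omega>))"
      using null by (subst integrable_cong_AE[where g = "\<lambda>_. 0"]) auto
    moreover have "(\<integral>\<omega>. indicator A \<omega> * exp (\<theta> * service Z \<tau> t \<omega>) \<partial>M) = 0"
      using null by (rule integral_eq_zero_AE)
    ultimately show ?thesis
      using True by (simp add: A_def)
  next
    case False
    then have pos: "prob A > 0"
      by (simp add: zero_less_measure_iff)
    let ?N = "uniform_measure M A"
    \<comment> \<open>Slots up to \<tau> are outside the sum and slots up to \<open>k\<close> are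
      asleep. The cardinality is \<open>t - max \<tau> k\<close> with truncated subtraction, so late
      wake-ups give an empty set and exponent 0.\<close>
    let ?I = "{max \<tau> k + 1..t}"
    interpret N: prob_space ?N
      using pos by (intro prob_space_uniform_measure) (auto simp: emeasure_eq_measure)
    have indep: "N.indep_vars (\<lambda>_. borel) Z ?I"
      and law: "\<And>s. s \<in> ?I \<Longrightarrow> distr ?N borel (Z s) = D"
    proof -
      have "N.indep_vars (\<lambda>_. borel) Z {k<..}"
        using iid pos unfolding iid_after_wakeup_def A_def by blast
      then show "N.indep_vars (\<lambda>_. borel) Z ?I"
        by (rule N.indep_vars_subset) auto
      show "distr ?N borel (Z s) = D" if "s \<in> ?I" for s
      proof -
        have "k < s"
          using that by auto
        then show ?thesis
          using iid pos unfolding iid_after_wakeup_def A_def by blast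
      qed
    qed
    have awake: "service Z \<tau> t \<omega> = (\<Sum>s\<in>?I. Z s \<omega>)" if "\<omega> \<in> A" for \<omega>
      unfolding service_def using that sleep
      by (intro sum.mono_neutral_right) (auto simp: A_def)
    have restrict: "indicator A \<omega> * exp (\<theta> * service Z \<tau> t \<omega>)
        = indicator A \<omega> * exp (\<theta> * (\<Sum>s\<in>?I. Z s \<omega>))" for \<omega>
      by (auto simp: awake indicator_def)
    have meas: "(\<lambda>\<omega>. exp (\<theta> * (\<Sum>s\<in>?I. Z s \<omega>))) \<in> borel_measurable M"
      by measurable
    note fin = finite_measure_axioms
    have "integrable M (\<lambda>\<omega>. indicator A \<omega> * exp (\<theta> * service Z \<tau> t \<omega>))"
      unfolding restrict
      by (rule integrable_uniform_measure_iff[OF fin A pos meas, THEN iffD1])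
        (rule N.integrable_exp_sum_iid[OF _ indep law int], simp_all)
    moreover have "(\<integral>\<omega>. indicator A \<omega> * exp (\<theta> * service Z \<tau> t \<omega>) \<partial>M)
        = prob A * mgf D (\<lambda>z. z) \<theta> ^ (t - max \<tau> k)"
      unfolding restrict integral_indicator_eq_uniform_measure[OF fin A pos meas]
      using N.mgf_sum_iid[OF _ indep law int] by (simp add: mgf_def)
    ultimately show ?thesis
      by (simp add: A_def mult.commute)
  qed
  then show ?int and ?eq by auto
qed

text \<open>Countably many null events cannot cover a probability space. The resulting
  \<open>k\<close> gives access to the law \<open>D\<close>, about which the iid hypothesis speaks
  only under such a conditioning.\<close>

lemma (in prob_space) ex_wakeup_time_pos:
  fixes T :: "'a \<Rightarrow> nat"
  assumes [measurable]: "T \<in> measurable M (count_space UNIV)"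
  shows "\<exists>k. \<P>(\<omega> in M. T \<omega> = k) > 0"
proof (rule ccontr)
  assume "\<nexists>k. \<P>(\<omega> in M. T \<omega> = k) > 0"
  then have "prob {\<omega> \<in> space M. T \<omega> = k} = 0" for k
    by (metis measure_nonneg order_le_less)
  then have "AE \<omega> in M. T \<omega> \<noteq> k" for k
    by (subst AE_iff_measurable[OF _ refl]) (auto simp: emeasure_eq_measure)
  then have "AE \<omega> in M. \<forall>k. T \<omega> \<noteq> k"
    by (subst AE_all_countable) blast
  then show False
    by (simp add: AE_False)
qed

theorem mainTheorem12:
  fixes M :: "'a measure"
    and Z :: "nat \<Rightarrow> 'a \<Rightarrow> real"
    and T :: "'a \<Rightarrow> nat"
    and D :: "real measure"
    and \<theta> :: real
    and \<tau> t :: nat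
  assumes "prob_space M"
    and "T \<in> measurable M (count_space UNIV)"
    and "\<And>s. Z s \<in> borel_measurable M"
    and "\<And>\<omega> s. \<omega> \<in> space M \<Longrightarrow> s \<le> T \<omega> \<Longrightarrow> Z s \<omega> = 0"
    and "\<tau> \<le> t"
  shows "mgf M (\<lambda>\<omega>. real (usable_slots T \<tau> t \<omega>)) \<theta> =
           exp (\<theta> * (real t - real \<tau>)) * \<P>(\<omega> in M. T \<omega> \<le> \<tau>)
           + (\<Sum>\<upsilon> = \<tau> + 1..t. exp (\<theta> * (real t - real \<upsilon>)) * \<P>(\<omega> in M. T \<omega> = \<upsilon>))
           + \<P>(\<omega> in M. T \<omega> > t)
       \<and> (iid_after_wakeup M Z T D \<and> integrable D (\<lambda>z. exp (\<theta> * z)) \<longrightarrow>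
           integrable M (\<lambda>\<omega>. exp (\<theta> * service Z \<tau> t \<omega>))
           \<and> mgf M (service Z \<tau> t) \<theta> =
               (\<integral>\<omega>. mgf D (\<lambda>z. z) \<theta> ^ usable_slots T \<tau> t \<omega> \<partial>M)
           \<and> (\<integral>\<omega>. mgf D (\<lambda>z. z) \<theta> ^ usable_slots T \<tau> t \<omega> \<partial>M) =
               mgf M (\<lambda>\<omega>. real (usable_slots T \<tau> t \<omega>)) (ln (mgf D (\<lambda>z. z) \<theta>)))"
proof -
  interpret prob_space M by fact
  let ?m = "mgf D (\<lambda>z. z) \<theta>"
  have "integrable M (\<lambda>\<omega>. exp (\<theta> * service Z \<tau> t \<omega>))
      \<and> mgf M (service Z \<tau> t) \<theta> = (\<integral>\<omega>. ?m ^ usable_slots T \<tau> t \<omega> \<partial>M)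
      \<and> (\<integral>\<omega>. ?m ^ usable_slots T \<tau> t \<omega> \<partial>M)
          = mgf M (\<lambda>\<omega>. real (usable_slots T \<tau> t \<omega>)) (ln ?m)"
    if iid: "iid_after_wakeup M Z T D" and int: "integrable D (\<lambda>z. exp (\<theta> * z))"
  proof -
    let ?c = "\<lambda>k. ?m ^ (t - max \<tau> k)"
    note given = integrable_exp_service_given_wakeup[OF assms(1-4) iid int]
      integral_exp_service_given_wakeup[OF assms(1-4) iid int]
    \<comment> \<open>The case \<open>T \<omega> = t\<close> belongs here because the increment at
      the wake-up time itself is still 0. Both sides equal 1.\<close>
    have asleep: "exp (\<theta> * service Z \<tau> t \<omega>) = ?c t" if "\<omega> \<in> space M" "t \<le> T \<omega>" for \<omega>
      using that assms(4) by (simp add: service_def)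
    have "integrable M (\<lambda>\<omega>. exp (\<theta> * service Z \<tau> t \<omega>))"
      by (rule integrable_truncated_partition[where c = ?c, OF assms(2) given asleep])
    moreover have "mgf M (service Z \<tau> t) \<theta>
        = (\<Sum>k<t. ?c k * \<P>(\<omega> in M. T \<omega> = k)) + ?c t * \<P>(\<omega> in M. t \<le> T \<omega>)"
      unfolding mgf_def[of M "service Z \<tau> t"]
      by (rule integral_truncated_partition[where c = ?c, OF assms(2) given asleep])
    \<comment> \<open>The right-hand side is literally that of the preceding equation, which yields
      the first claimed equality.\<close>
    moreover have "(\<integral>\<omega>. ?m ^ usable_slots T \<tau> t \<omega> \<partial>M)
        = (\<Sum>k<t. ?c k * \<P>(\<omega> in M. T \<omega> = k)) + ?c t * \<P>(\<omega> in M. t \<le> T \<omega>)"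
      unfolding usable_slots_def
      by (rule integral_truncated_nat[OF assms(2)]) simp
    \<comment> \<open>Positivity of ?m keeps ln ?m away from the junk values of ln; it needs the law D
      to be a genuine distribution, which follows from the hypothesis at one k of positive probability.\<close>
    moreover have "?m > 0"
    proof -
      obtain k where k: "\<P>(\<omega> in M. T \<omega> = k) > 0"
        using ex_wakeup_time_pos[OF assms(2)] by blast
      interpret N: prob_space "uniform_measure M {\<omega> \<in> space M. T \<omega> = k}"
        using k by (intro prob_space_uniform_measure) (auto simp: emeasure_eq_measure)
      \<comment> \<open>Slot \<open>Suc k\<close> is the first one awake given \<open>T = k\<close>,
        so its increment has law \<open>D\<close> whatever \<tau> and \<open>t\<close> are.\<close>
      show ?thesis
        using iid k assms(3) int unfolding iid_after_wakeup_def
        by (intro N.mgf_law_pos[of "Z (Suc k)"]) auto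
    qed
    then have "mgf M (\<lambda>\<omega>. real (usable_slots T \<tau> t \<omega>)) (ln ?m)
        = (\<integral>\<omega>. ?m ^ usable_slots T \<tau> t \<omega> \<partial>M)"
      by (simp add: mgf_def[of M] mult.commute exp_of_nat_mult)
    ultimately show ?thesis by simp
  qed
  then show ?thesis
    using mgf_usable_slots[OF assms(2,5)] by blast
qed

end
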